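(* Let $a_1,\ldots,a_5$ be real with $|a_j|<1$ for $j=1,\ldots,5$, and $\mathbf a^{(5)}=(a_1,\ldots,a_5)$. Then: (i) for every integer $n\ge0$, $$\begin{aligned}\sigma_n^{(4)}(a_1,a_2,a_3,a_4|0)={}&S_n^{(2)}(a_2,a_4|0)+\frac{(1-a_2a_4)(1-a_1a_4)}{1-a_1a_2a_3a_4}\,a_3\,S_{n-1}^{(3)}(a_2,a_3,a_4|0)\\&+\frac{(1-a_2a_4)(1-a_3a_2)}{1-a_1a_2a_3a_4}\,a_1\,S_{n-1}^{(3)}(a_1,a_2,a_4|0)\\&+\frac{(1-a_2a_4)(1-a_2a_3)(1-a_1a_4)\,a_1a_3}{1-a_1a_2a_3a_4}\,S_{n-2}^{(4)}(a_1,a_2,a_3,a_4|0);\end{aligned}$$ (ii) $$\int_{-1}^1 g_5(x|\mathbf a^{(5)},0)\,dx=\frac{1-e_4(\mathbf a^{(5)})+e_5(\mathbf a^{(5)})\,e_1(\mathbf a^{(5)})-e_5(\mathbf a^{(5)})^2}{\prod_{1\le j<k\le5}(1-a_ja_k)},$$ where $e_1,\ldots,e_5$ are the elementary symmetric functions of $\mathbf a^{(5)}$, i.e. $e_j(\mathbf a^{(5)})=\sum_{1\le n_1<\cdots<n_j\le5}\prod_{m=1}^j a_{n_m}$.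
   Context: All objects are taken at $q=0$ (with $0^0=1$). $g_5(x|\mathbf a^{(5)},0)=\frac{2\sqrt{1-x^2}}{\pi}\prod_{j=1}^5\frac{1}{1-2a_jx+a_j^2}$ for $x\in[-1,1]$. For $n\ge0$, $S_n^{(k)}(a_1,\ldots,a_k|0)=\sum_{j_1+\cdots+j_k=n,\ j_i\ge0}a_1^{j_1}\cdots a_k^{j_k}$ (complete homogeneous symmetric polynomial; all $q$-multinomial coefficients equal $1$ at $q=0$), and $S_n^{(k)}=0$ for $n<0$. In general, $\sigma_n^{(4)}(a,b,c,d|q)=\sum_{j=0}^{n}\binom{n}{j}_q\frac{(bd)_j}{(abcd)_j}S_{n-j}^{(2)}(b,d|q)\sum_{k=0}^{j}\binom{j}{k}_q (cb)_k a^k (ad)_{j-k}c^{j-k}$, where $(a)_n=\prod_{j=0}^{n-1}(1-aq^j)$ and $\binom{n}{k}_q$ is the $q$-binomial coefficient. At $q=0$: $\binom{n}{k}_0=1$ for $0\le k\le n$, $(a)_0=1$ and $(a)_n=1-a$ for $n\ge1$; thus $$\sigma_n^{(4)}(a,b,c,d|0)=\sum_{j=0}^{n}\frac{(bd)_j}{(abcd)_j}S_{n-j}^{(2)}(b,d|0)\sum_{k=0}^{j}(cb)_k a^k (ad)_{j-k}c^{j-k}.$$ *)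

theory Defs
  imports "HOL-Analysis.Analysis"
begin

definition q_pochhammer :: "real \<Rightarrow> real \<Rightarrow> nat \<Rightarrow> real" where
  "q_pochhammer a q n = (\<Prod>j<n. 1 - a * q ^ j)"

text \<open>
  The quotient definition of the \<open>q\<close>-coefficients is meant for \<open>\<bar>q\<bar> < 1\<close>, where no denominator
  vanishes. Isabelle's \<open>0 ^ 0 = 1\<close> agrees with the usual convention for \<open>q = 0\<close>.
\<close>

definition q_binomial :: "real \<Rightarrow> nat \<Rightarrow> nat \<Rightarrow> real" where
  "q_binomial q n k =
    (if k \<le> n then q_pochhammer q q n / (q_pochhammer q q k * q_pochhammer q q (n - k)) else 0)"

definition q_multinomial :: "real \<Rightarrow> nat list \<Rightarrow> real" where
  "q_multinomial q js = q_pochhammer q q (sum_list js) / (\<Prod>j\<leftarrow>js. q_pochhammer q q j)"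

text \<open>
  \<open>S_poly n [a\<^sub>1, \<dots>, a\<^sub>k] q\<close> is \<open>S\<^sub>n\<^sup>(\<^sup>k\<^sup>)(a\<^sub>1, \<dots>, a\<^sub>k|q)\<close>; the lists \<open>js\<close> are
  the exponent tuples \<open>(j\<^sub>1, \<dots>, j\<^sub>k)\<close>.
\<close>

definition S_poly :: "int \<Rightarrow> real list \<Rightarrow> real \<Rightarrow> real" where
  "S_poly n as q =
    (if n < 0 then 0
     else \<Sum>js | length js = length as \<and> sum_list js = nat n.
            q_multinomial q js * (\<Prod>i<length as. (as ! i) ^ (js ! i)))"

definition sigma4 :: "nat \<Rightarrow> real \<Rightarrow> real \<Rightarrow> real \<Rightarrow> real \<Rightarrow> real \<Rightarrow> real" where
  "sigma4 n a b c d q =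
    (\<Sum>j=0..n. q_binomial q n j
        * (q_pochhammer (b * d) q j / q_pochhammer (a * b * c * d) q j)
        * S_poly (int (n - j)) [b, d] q
        * (\<Sum>k=0..j. q_binomial q j k * q_pochhammer (c * b) q k * a ^ k
                     * q_pochhammer (a * d) q (j - k) * c ^ (j - k)))"

text \<open>The parameter vector is \<open>a 1, \<dots>, a 5\<close>; other values of \<open>a\<close> are ignored.\<close>

definition g5_q0 :: "(nat \<Rightarrow> real) \<Rightarrow> real \<Rightarrow> real" where
  "g5_q0 a x = 2 * sqrt (1 - x\<^sup>2) / pi * (\<Prod>j=1..5. 1 / (1 - 2 * a j * x + (a j)\<^sup>2))"

definition elem_sym5 :: "nat \<Rightarrow> (nat \<Rightarrow> real) \<Rightarrow> real" where
  "elem_sym5 j a = (\<Sum>N | N \<subseteq> {1..5} \<and> card N = j. \<Prod>m\<in>N. a m)"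

lemma q_pochhammer_q0: "q_pochhammer a 0 n = (if n = 0 then 1 else 1 - a)"
  by (induction n) (auto simp: q_pochhammer_def)

lemma q_binomial_q0: "q_binomial 0 n k = (if k \<le> n then 1 else 0)"
  by (simp add: q_binomial_def q_pochhammer_q0)

lemma q_multinomial_q0: "q_multinomial 0 js = 1"
proof -
  have "(\<Prod>j\<leftarrow>js. q_pochhammer 0 0 j) = 1"
    by (induction js) (auto simp: q_pochhammer_q0)
  then show ?thesis
    by (simp add: q_multinomial_def q_pochhammer_q0)
qed

lemma S_poly_q0:
  "S_poly (int n) as 0 =
    (\<Sum>js | length js = length as \<and> sum_list js = n. \<Prod>i<length as. (as ! i) ^ (js ! i))"
  by (simp add: S_poly_def q_multinomial_q0)

lemma sigma4_q0:
  "sigma4 n a b c d 0 =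
    (\<Sum>j=0..n. q_pochhammer (b * d) 0 j / q_pochhammer (a * b * c * d) 0 j
        * S_poly (int (n - j)) [b, d] 0
        * (\<Sum>k=0..j. q_pochhammer (c * b) 0 k * a ^ k * q_pochhammer (a * d) 0 (j - k) * c ^ (j - k)))"
  by (simp add: sigma4_def q_binomial_q0)

end

theory Submission
  imports Defs "HOL-Computational_Algebra.Formal_Power_Series"
begin

text \<open>
  The expansion of \<open>sigma4\<close> is an identity of generating functions. At \<open>q = 0\<close> the series
  \<open>\<Sum>n. S\<^sub>n t\<^sup>n\<close> is the product of the geometric series of the parameters, and a factor
  \<open>q_pochhammer u 0 n\<close> differs from the constant \<open>1 - u\<close> only at \<open>n = 0\<close>. The nested convolution that
  defines \<open>sigma4\<close> therefore becomes a product of geometric series with corrections to the constant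
  terms (\<open>sigma4_generating_function\<close>), and multiplying this product out yields the four summands, a
  factor \<open>t\<^sup>m\<close> accounting for the index shift by \<open>m\<close>.

  The integral is computed by adding the parameters one at a time. With
  \<open>D\<^sub>a(x) = 1 - 2ax + a\<^sup>2\<close> the combination \<open>u D\<^sub>a - a D\<^sub>u = (u - a)(1 - au)\<close> is free of \<open>x\<close>, so
  \<open>1 / (D\<^sub>a D\<^sub>u)\<close> is a linear combination of \<open>1 / D\<^sub>a\<close> and \<open>1 / D\<^sub>u\<close> as long as \<open>u \<noteq> a\<close>
  (and \<open>a u \<noteq> 1\<close>, which holds for parameters in \<open>(-1, 1)\<close>). If \<open>F(u)\<close> is an integral with the factor
  \<open>1 / D\<^sub>u\<close>, the same integral with the further factor \<open>1 / D\<^sub>a\<close> is therefore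
  \<open>(u F(u) - a F(a)) / ((u - a)(1 - a u))\<close>, and the case \<open>u = a\<close> follows by continuity in the parameter
  (\<open>integral_extra_cheb_den\<close>). The starting value
  \<open>\<integral> (2/\<pi>) \<surd>(1 - x\<^sup>2) / D\<^sub>a = 1\<close> comes from an explicit antiderivative, and each of the four further
  steps reduces to a polynomial identity between the closed forms. It is in the last step that the
  numerator \<open>1 - e\<^sub>4 + e\<^sub>5 e\<^sub>1 - e\<^sub>5\<^sup>2\<close> arises.
\<close>

section \<open>Generating functions at q = 0\<close>

abbreviation geometric_fps :: "real \<Rightarrow> real fps" where
  "geometric_fps x \<equiv> Abs_fps (\<lambda>n. x ^ n)"

lemma S_poly_Nil_q0: "S_poly (int n) [] 0 = (if n = 0 then 1 else 0)"
proof -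
  have "{js :: nat list. length js = 0 \<and> sum_list js = n} = (if n = 0 then {[]} else {})"
    by auto
  then show ?thesis by (simp add: S_poly_q0)
qed

lemma finite_exponent_lists: "finite {js :: nat list. length js = k \<and> sum_list js = n}"
proof (rule finite_subset)
  show "{js. length js = k \<and> sum_list js = n} \<subseteq> {js. set js \<subseteq> {..n} \<and> length js = k}"
    using member_le_sum_list by fastforce
  show "finite {js. set js \<subseteq> {..n} \<and> length js = k}"
    by (simp add: finite_lists_length_eq)
qed

text \<open>
  Splitting off the exponent of the first variable turns \<open>S_poly\<close> into a convolution, the form in which
  it can be compared with a product of power series.
\<close>

lemma S_poly_Cons_q0:
  "S_poly (int n) (x # xs) 0 = (\<Sum>j=0..n. x ^ j * S_poly (int (n - j)) xs 0)"
proof -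
  let ?T = "\<lambda>j. {js :: nat list. length js = length xs \<and> sum_list js = n - j}"
  let ?mon = "\<lambda>as js. \<Prod>i<length as. (as ! i) ^ (js ! i) :: real"
  have mon_Cons: "?mon (x # xs) (j # js) = x ^ j * ?mon xs js" for j js
    by (simp add: prod.lessThan_Suc_shift del: prod.lessThan_Suc)
  have "S_poly (int n) (x # xs) 0
      = (\<Sum>js | length js = length (x # xs) \<and> sum_list js = n. ?mon (x # xs) js)"
    by (rule S_poly_q0)
  also have "\<dots> = (\<Sum>(j, js)\<in>Sigma {0..n} ?T. x ^ j * ?mon xs js)"
  proof (rule sum.reindex_bij_witness[where i = "\<lambda>(j, js). j # js" and j = "\<lambda>js. (hd js, tl js)"])
    fix js assume "js \<in> {js. length js = length (x # xs) \<and> sum_list js = n}"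
    then obtain k ks where js: "js = k # ks" "length ks = length xs" "k + sum_list ks = n"
      by (cases js) auto
    then show "(case (hd js, tl js) of (j, js) \<Rightarrow> j # js) = js"
      "(hd js, tl js) \<in> Sigma {0..n} ?T" by auto
    show "(case (hd js, tl js) of (j, js) \<Rightarrow> x ^ j * ?mon xs js) = ?mon (x # xs) js"
      using mon_Cons[of k ks] js by simp
  qed auto
  also have "\<dots> = (\<Sum>j=0..n. x ^ j * S_poly (int (n - j)) xs 0)"
    by (simp add: sum.Sigma[symmetric] finite_exponent_lists S_poly_q0 sum_distrib_left
        del: of_nat_diff)
  finally show ?thesis .
qed

text \<open>
  Products of power series commute, so in this form the symmetry of \<open>S_poly\<close> in its arguments and the
  merging of convolutions need no separate argument.
\<close>

lemma S_poly_generating_function: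
  "Abs_fps (\<lambda>n. S_poly (int n) xs 0) = (\<Prod>x\<leftarrow>xs. geometric_fps x)"
proof (induction xs)
  case Nil
  show ?case by (rule fps_ext) (simp add: S_poly_Nil_q0)
next
  case (Cons x xs)
  have "Abs_fps (\<lambda>n. S_poly (int n) (x # xs) 0)
      = geometric_fps x * Abs_fps (\<lambda>n. S_poly (int n) xs 0)"
    by (rule fps_ext) (simp add: S_poly_Cons_q0 fps_mult_nth)
  then show ?case by (simp add: Cons.IH)
qed

lemma S_poly_eq_coeff:
  "S_poly (int n) xs 0 = fps_nth (\<Prod>x\<leftarrow>xs. geometric_fps x) n"
  by (simp flip: S_poly_generating_function)

text \<open>
  The convention that \<open>S_poly\<close> vanishes at negative indices is what makes shifting the index the same as
  multiplying by a power of \<open>fps_X\<close>.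
\<close>

lemma S_poly_shift_eq_coeff:
  "S_poly (int n - int m) xs 0 = fps_nth (fps_X ^ m * (\<Prod>x\<leftarrow>xs. geometric_fps x)) n"
proof (cases "n < m")
  case True
  then show ?thesis by (simp add: S_poly_def fps_X_power_mult_nth)
next
  case False
  then have "int n - int m = int (n - m)" by simp
  with False show ?thesis by (simp only: S_poly_eq_coeff) (simp add: fps_X_power_mult_nth)
qed

text \<open>
  At \<open>q = 0\<close> the weight is \<open>1 - u\<close> for every \<open>n \<ge> 1\<close> but \<open>1\<close> for \<open>n = 0\<close>, which leaves the constant term
  apart from a multiple of the shifted geometric series.
\<close>

lemma q_pochhammer_weighted_geometric:
  "Abs_fps (\<lambda>n. q_pochhammer u 0 n * x ^ n) = 1 + fps_const ((1 - u) * x) * fps_X * geometric_fps x"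
proof (rule fps_ext)
  fix n
  show "fps_nth (Abs_fps (\<lambda>n. q_pochhammer u 0 n * x ^ n)) n
      = fps_nth (1 + fps_const ((1 - u) * x) * fps_X * geometric_fps x) n"
    by (cases n) (simp_all add: q_pochhammer_q0 mult.assoc)
qed

text \<open>
  The inner sum of \<open>sigma4\<close> is the Cauchy product of two weighted geometric series \<open>A\<close> and \<open>C\<close>, and the
  outer sum is its Cauchy product with the series of \<open>S_poly\<close> in \<open>b\<close> and \<open>d\<close>. The quotient of
  \<open>q_pochhammer\<close> values is the constant \<open>r\<close> except at \<open>j = 0\<close>, where it is \<open>1\<close>; hence \<open>r\<close> multiplies only
  \<open>A * C - 1\<close>, the part without constant term.
\<close>

lemma sigma4_generating_function:
  fixes a b c d :: real
  defines "r \<equiv> (1 - b * d) / (1 - a * b * c * d)"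
  shows "Abs_fps (\<lambda>n. sigma4 n a b c d 0) =
    geometric_fps b * geometric_fps d * (1 + fps_const r *
      ((1 + fps_const ((1 - c * b) * a) * fps_X * geometric_fps a)
        * (1 + fps_const ((1 - a * d) * c) * fps_X * geometric_fps c) - 1))"
proof -
  define A where "A = Abs_fps (\<lambda>n. q_pochhammer (c * b) 0 n * a ^ n)"
  define C where "C = Abs_fps (\<lambda>n. q_pochhammer (a * d) 0 n * c ^ n)"
  have ratio: "q_pochhammer (b * d) 0 j / q_pochhammer (a * b * c * d) 0 j
      * fps_nth (A * C) j = fps_nth (1 + fps_const r * (A * C - 1)) j" for j
    by (cases j) (simp_all add: r_def A_def C_def q_pochhammer_q0)
  have "Abs_fps (\<lambda>n. sigma4 n a b c d 0)
      = (1 + fps_const r * (A * C - 1)) * Abs_fps (\<lambda>n. S_poly (int n) [b, d] 0)"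
  proof (rule fps_ext)
    fix n
    have "sigma4 n a b c d 0 = (\<Sum>j=0..n. q_pochhammer (b * d) 0 j
        / q_pochhammer (a * b * c * d) 0 j * fps_nth (A * C) j * S_poly (int (n - j)) [b, d] 0)"
      by (simp add: sigma4_q0 A_def C_def fps_mult_nth mult_ac)
    then show "fps_nth (Abs_fps (\<lambda>n. sigma4 n a b c d 0)) n = fps_nth
        ((1 + fps_const r * (A * C - 1)) * Abs_fps (\<lambda>n. S_poly (int n) [b, d] 0)) n"
      by (simp only: ratio) (simp add: fps_mult_nth)
  qed
  then show ?thesis
    by (simp only: A_def C_def q_pochhammer_weighted_geometric S_poly_generating_function)
      (simp add: mult_ac)
qed

text \<open>
  In the product \<open>(1 + \<alpha> X G\<^sub>a)(1 + \<gamma> X G\<^sub>c) - 1\<close> of the generating function, the two terms linear in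
  \<open>X\<close> and the mixed term contribute one summand each, in addition to \<open>S\<^sub>n(b, d)\<close>.
\<close>

lemma sigma4_expansion:
  fixes a b c d :: real
  shows "sigma4 n a b c d 0 =
    S_poly (int n) [b, d] 0
    + (1 - b * d) * (1 - a * d) / (1 - a * b * c * d) * c * S_poly (int n - 1) [b, c, d] 0
    + (1 - b * d) * (1 - c * b) / (1 - a * b * c * d) * a * S_poly (int n - 1) [a, b, d] 0
    + (1 - b * d) * (1 - b * c) * (1 - a * d) * a * c / (1 - a * b * c * d)
        * S_poly (int n - 2) [a, b, c, d] 0"
proof -
  define r where "r = (1 - b * d) / (1 - a * b * c * d)"
  let ?G = geometric_fps and ?X = "fps_X :: real fps"
  let ?S = "\<lambda>xs. \<Prod>x\<leftarrow>xs. ?G x"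
  have "Abs_fps (\<lambda>n. sigma4 n a b c d 0) = ?G b * ?G d * (1 + fps_const r *
      ((1 + fps_const ((1 - c * b) * a) * ?X * ?G a)
        * (1 + fps_const ((1 - a * d) * c) * ?X * ?G c) - 1))"
    unfolding r_def by (rule sigma4_generating_function)
  also have "\<dots> = ?S [b, d]
      + fps_const r * fps_const ((1 - a * d) * c) * (?X ^ 1 * ?S [b, c, d])
      + fps_const r * fps_const ((1 - c * b) * a) * (?X ^ 1 * ?S [a, b, d])
      + fps_const r * fps_const ((1 - c * b) * a) * fps_const ((1 - a * d) * c)
        * (?X ^ 2 * ?S [a, b, c, d])"
    by (simp add: algebra_simps power2_eq_square del: fps_const_mult)
  finally have "fps_nth (Abs_fps (\<lambda>n. sigma4 n a b c d 0)) n = fps_nth (?S [b, d]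
      + fps_const (r * ((1 - a * d) * c)) * (?X ^ 1 * ?S [b, c, d])
      + fps_const (r * ((1 - c * b) * a)) * (?X ^ 1 * ?S [a, b, d])
      + fps_const (r * ((1 - c * b) * a) * ((1 - a * d) * c)) * (?X ^ 2 * ?S [a, b, c, d])) n"
    by (simp only: fps_const_mult)
  then have "sigma4 n a b c d 0 = S_poly (int n) [b, d] 0
      + r * ((1 - a * d) * c) * S_poly (int n - int 1) [b, c, d] 0
      + r * ((1 - c * b) * a) * S_poly (int n - int 1) [a, b, d] 0
      + r * ((1 - c * b) * a) * ((1 - a * d) * c) * S_poly (int n - int 2) [a, b, c, d] 0"
    by (simp only: fps_add_nth fps_mult_left_const_nth fps_nth_Abs_fps
        S_poly_eq_coeff S_poly_shift_eq_coeff)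
  then show ?thesis by (simp add: r_def mult_ac)
qed

section \<open>The Chebyshev denominators\<close>

text \<open>
  The reciprocal of \<open>1 - 2ax + a\<^sup>2\<close> is the generating function, in \<open>a\<close>, of the Chebyshev polynomials of
  the second kind, for which the semicircle density is the orthogonality weight.
\<close>

definition cheb_den :: "real \<Rightarrow> real \<Rightarrow> real" where
  "cheb_den a x = 1 - 2 * a * x + a\<^sup>2"

lemma cheb_den_pos:
  assumes "\<bar>a\<bar> < 1" "x \<in> {-1..1}"
  shows "cheb_den a x > 0"
proof -
  have "a * x \<le> \<bar>a\<bar> * 1"
    using abs_ge_self[of "a * x"] mult_left_mono[of "\<bar>x\<bar>" 1 "\<bar>a\<bar>"] assms(2)
    by (simp add: abs_mult abs_le_iff)
  then have "cheb_den a x \<ge> (1 - \<bar>a\<bar>)\<^sup>2"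
    by (simp add: cheb_den_def power2_diff)
  with assms show ?thesis
    by (smt (verit) zero_less_power)
qed

lemma one_minus_mult_nonzero:
  fixes a b :: real
  assumes "\<bar>a\<bar> < 1" "\<bar>b\<bar> < 1"
  shows "1 - a * b \<noteq> 0"
proof -
  have "\<bar>a * b\<bar> < 1 * 1"
    unfolding abs_mult using assms by (intro mult_strict_mono') auto
  then show ?thesis by auto
qed

lemma continuous_on_cheb_den [continuous_intros]:
  assumes "continuous_on S f" "continuous_on S g"
  shows "continuous_on S (\<lambda>x. cheb_den (f x) (g x))"
  unfolding cheb_den_def by (intro continuous_intros assms)

text \<open>
  The right-hand side does not depend on \<open>x\<close>: this is what lets a product of two denominators be
  separated into partial fractions.
\<close>

lemma cheb_den_partial_fractions:
  "u * cheb_den a x - a * cheb_den u x = (u - a) * (1 - a * u)"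
  by (simp add: cheb_den_def algebra_simps power2_eq_square)

section \<open>Adding one parameter to an integral\<close>

lemma continuous_on_integral_over_cheb_den:
  assumes "continuous_on {-1..1} h"
  shows "continuous_on {-1<..<1} (\<lambda>u. integral {-1..1} (\<lambda>x. h x / cheb_den u x))"
proof -
  have "continuous_on ({-1<..<1} \<times> {-1..1}) (\<lambda>(u, x). h x / cheb_den u x)"
    unfolding case_prod_beta
  proof (intro continuous_intros)
    show "continuous_on ({-1<..<1::real} \<times> {-1..1}) (\<lambda>p. h (snd p))"
      by (rule continuous_on_compose2[OF assms]) (auto intro: continuous_intros)
    show "\<forall>p\<in>{-1<..<1} \<times> {-1..1}. cheb_den (fst p) (snd p) \<noteq> 0"
      using cheb_den_pos by (fastforce simp: abs_less_iff)
  qed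
  then show ?thesis
    using integral_continuous_on_param[of "{-1<..<1::real}" "-1::real" 1 "\<lambda>u x. h x / cheb_den u x"]
    by simp
qed

text \<open>
  Used to fill in the single parameter value at which a formula degenerates: \<open>u = a\<close> for partial
  fractions, and \<open>a = 0\<close> for the antiderivative below.
\<close>

lemma continuous_eq_at_puncture:
  fixes f g :: "real \<Rightarrow> real"
  assumes "continuous_on {-1<..<1} f" "continuous_on {-1<..<1} g" "c \<in> {-1<..<1}"
    and eq: "\<And>u. u \<in> {-1<..<1} \<Longrightarrow> u \<noteq> c \<Longrightarrow> f u = g u"
  shows "f c = g c"
proof (rule tendsto_unique)
  show "(f \<longlongrightarrow> f c) (at c)"
    using assms(1,3) by (auto simp: continuous_on_eq_continuous_at isCont_def)
  have "(g \<longlongrightarrow> g c) (at c)"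
    using assms(2,3) by (auto simp: continuous_on_eq_continuous_at isCont_def)
  moreover have "\<forall>\<^sub>F u in at c. g u = f u"
    using eventually_at_in_open[of "{-1<..<1}" c] assms(3)
    by (auto elim!: eventually_mono simp: eq)
  ultimately show "(f \<longlongrightarrow> g c) (at c)"
    by (rule Lim_transform_eventually)
qed auto

text \<open>
  Knowing the integral \<open>F\<close> of a weight \<open>h\<close> against every single denominator determines its integral
  against every pair of denominators. By partial fractions the latter is
  \<open>(u F(u) - a F(a)) / ((u - a)(1 - a u))\<close> when \<open>u \<noteq> a\<close>. The function \<open>G\<close> is a closed form of this quotient
  without the removable singularity at \<open>u = a\<close>; being continuous, it gives the value there too.
\<close>

lemma integral_extra_cheb_den:
  fixes h F G :: "real \<Rightarrow> real"
  assumes h: "continuous_on {-1..1} h"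
    and F: "\<And>u. \<bar>u\<bar> < 1 \<Longrightarrow> integral {-1..1} (\<lambda>x. h x / cheb_den u x) = F u"
    and G: "continuous_on {-1<..<1} G"
    and FG: "\<And>u. \<bar>u\<bar> < 1 \<Longrightarrow> (u - a) * (1 - a * u) * G u = u * F u - a * F a"
    and a: "\<bar>a\<bar> < 1" and u: "\<bar>u\<bar> < 1"
  shows "integral {-1..1} (\<lambda>x. h x / cheb_den a x / cheb_den u x) = G u"
proof -
  have nz: "cheb_den v x \<noteq> 0" if "\<bar>v\<bar> < 1" "x \<in> {-1..1}" for v x
    using cheb_den_pos[OF that] by simp
  let ?J = "\<lambda>u. integral {-1..1} (\<lambda>x. h x / cheb_den a x / cheb_den u x)"
  have F': "((\<lambda>x. h x / cheb_den v x) has_integral F v) {-1..1}" if v: "\<bar>v\<bar> < 1" for v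
  proof -
    have "(\<lambda>x. h x / cheb_den v x) integrable_on {-1..1}"
      by (intro integrable_continuous_real continuous_intros h ballI nz v)
    then show ?thesis using F[OF v] by (simp add: has_integral_iff)
  qed
  have distinct: "?J v = G v" if v: "\<bar>v\<bar> < 1" "v \<noteq> a" for v
  proof -
    let ?k = "(v - a) * (1 - a * v)"
    have "?k \<noteq> 0" using one_minus_mult_nonzero[OF a v(1)] v(2) by simp
    have "?k * ?J v = integral {-1..1} (\<lambda>x. ?k * (h x / cheb_den a x / cheb_den v x))"
      by (simp only: integral_mult_right)
    also have "\<dots> = integral {-1..1} (\<lambda>x. v * (h x / cheb_den v x) - a * (h x / cheb_den a x))"
    proof (rule integral_cong)
      fix x :: real assume x: "x \<in> {-1..1}"
      show "?k * (h x / cheb_den a x / cheb_den v x) = v * (h x / cheb_den v x) - a * (h x / cheb_den a x)"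
        unfolding cheb_den_partial_fractions[of v a x, symmetric]
        using nz[OF a x] nz[OF v(1) x] by (simp add: field_simps)
    qed
    also have "\<dots> = v * F v - a * F a"
      by (intro integral_unique has_integral_diff has_integral_mult_right F' a v)
    also have "\<dots> = ?k * G v" using FG[OF v(1)] by simp
    finally show ?thesis using \<open>?k \<noteq> 0\<close> by simp
  qed
  show ?thesis
  proof (cases "u = a")
    case True
    have "continuous_on {-1<..<1} ?J"
      by (rule continuous_on_integral_over_cheb_den) (intro continuous_intros h ballI nz a, auto)
    then have "?J a = G a"
      by (rule continuous_eq_at_puncture[OF _ G]) (use a distinct in auto)
    with True show ?thesis by simp
  qed (use distinct u in simp)
qed

section \<open>The base case: a single parameter\<close>

definition semicircle :: "real \<Rightarrow> real" where
  "semicircle x = 2 * sqrt (1 - x\<^sup>2) / pi"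

lemma continuous_on_semicircle: "continuous_on S semicircle"
  unfolding semicircle_def by (intro continuous_intros) auto

text \<open>
  The map \<open>m\<close> is the Moebius transformation of \<open>[-1, 1]\<close> that fixes both end points and sends
  \<open>2 a / (1 + a\<^sup>2)\<close> to \<open>0\<close>. It satisfies \<open>\<surd>(1 - m\<^sup>2) = (1 - a\<^sup>2) \<surd>(1 - x\<^sup>2) / D\<close> and
  \<open>m' = (1 - a\<^sup>2)\<^sup>2 / D\<^sup>2\<close> for the denominator \<open>D\<close>, so that \<open>arcsin \<circ> m\<close> is an antiderivative of
  \<open>(1 - a\<^sup>2) / (D \<surd>(1 - x\<^sup>2))\<close>. Dividing \<open>1 - x\<^sup>2\<close> by \<open>D\<close> as polynomials in \<open>x\<close> reduces the integrand to
  this function and the derivatives of \<open>arcsin\<close> and \<open>\<surd>(1 - x\<^sup>2)\<close>. For \<open>a = 0\<close>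
  the denominator is constant and the reduction degenerates.
\<close>

lemma has_integral_sqrt_over_cheb_den:
  assumes a: "\<bar>a\<bar> < 1" "a \<noteq> 0"
  shows "((\<lambda>x. sqrt (1 - x\<^sup>2) / cheb_den a x) has_integral pi / 2) {-1..1}"
proof -
  define m where "m x = ((1 + a\<^sup>2) * x - 2 * a) / cheb_den a x" for x
  define P where "P x = (arcsin x * ((1 + a\<^sup>2) / (2 * a)) - sqrt (1 - x\<^sup>2)) / (2 * a)
      - arcsin (m x) * ((1 - a\<^sup>2) / (4 * a\<^sup>2))" for x
  have a2: "a\<^sup>2 < 1" using a by (simp add: abs_square_less_1)
  \<comment> \<open>These factorizations bound \<open>m\<close>, give its values at the end points, and multiply to \<open>1 - m\<^sup>2\<close>.\<close>
  have m_upper: "1 - m x = (1 - x) * (1 + a)\<^sup>2 / cheb_den a x"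
    and m_lower: "1 + m x = (1 + x) * (1 - a)\<^sup>2 / cheb_den a x" if "x \<in> {-1..1}" for x
    using cheb_den_pos[OF a(1) that]
    by (simp_all add: m_def field_simps) (simp_all add: cheb_den_def algebra_simps power2_eq_square)
  have "P 1 = (pi / 2 * ((1 + a\<^sup>2) / (2 * a))) / (2 * a) - pi / 2 * ((1 - a\<^sup>2) / (4 * a\<^sup>2))"
    using m_upper[of 1] by (simp add: P_def)
  moreover have "P (-1) = - (pi / 2 * ((1 + a\<^sup>2) / (2 * a))) / (2 * a) + pi / 2 * ((1 - a\<^sup>2) / (4 * a\<^sup>2))"
  proof -
    have "m (-1) = -1" using m_lower[of "-1"] by simp
    then show ?thesis by (simp add: P_def)
  qed
  ultimately have "P 1 - P (-1) = pi / 2"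
    using a(2) by (simp add: field_simps power2_eq_square)
  moreover have "((\<lambda>x. sqrt (1 - x\<^sup>2) / cheb_den a x) has_integral P 1 - P (-1)) {-1..1}"
  proof (rule fundamental_theorem_of_calculus_interior)
    have "-1 \<le> m x \<and> m x \<le> 1" if x: "x \<in> {-1..1}" for x
    proof -
      have "1 - m x \<ge> 0" "1 + m x \<ge> 0"
        unfolding m_upper[OF x] m_lower[OF x] using cheb_den_pos[OF a(1) x] x by auto
      then show ?thesis by simp
    qed
    then show "continuous_on {-1..1} P"
      using cheb_den_pos[OF a(1)] a(2) unfolding P_def m_def
      by (intro continuous_intros) fastforce+
    fix x :: real assume x: "x \<in> {-1<..<1}"
    then have x': "x \<in> {-1..1}" by auto
    have x2: "1 - x\<^sup>2 > 0" using x by (simp add: abs_square_less_1 abs_less_iff)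
    define s where "s = sqrt (1 - x\<^sup>2)"
    define Q where "Q = cheb_den a x"
    have s: "s > 0" "s\<^sup>2 = 1 - x\<^sup>2" using x2 by (simp_all add: s_def)
    have Q: "Q > 0" using cheb_den_pos[OF a(1) x'] by (simp add: Q_def)
    have pm: "1 - m x > 0" "1 + m x > 0"
      unfolding m_upper[OF x'] m_lower[OF x'] using cheb_den_pos[OF a(1) x'] x a
      by (auto intro!: divide_pos_pos mult_pos_pos)
    have "1 - (m x)\<^sup>2 = (1 - m x) * (1 + m x)"
      by (simp add: algebra_simps power2_eq_square)
    also have "\<dots> = ((1 - a\<^sup>2) * s / Q)\<^sup>2"
      unfolding m_upper[OF x'] m_lower[OF x'] power_mult_distrib power_divide s(2) Q_def
      by (simp add: field_simps) (simp add: algebra_simps power2_eq_square)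
    finally have sqrt_m: "sqrt (1 - (m x)\<^sup>2) = (1 - a\<^sup>2) * s / Q"
      using s Q a2 by simp
    have "(m has_real_derivative
        ((1 + a\<^sup>2) * Q - ((1 + a\<^sup>2) * x - 2 * a) * (- (2 * a))) / (Q * Q)) (at x)"
      unfolding m_def cheb_den_def Q_def using Q
      by (auto intro!: derivative_eq_intros simp: Q_def cheb_den_def)
    also have "(1 + a\<^sup>2) * Q - ((1 + a\<^sup>2) * x - 2 * a) * (- (2 * a)) = (1 - a\<^sup>2)\<^sup>2"
      unfolding Q_def cheb_den_def by (simp add: algebra_simps power2_eq_square)
    finally have dm: "(m has_real_derivative (1 - a\<^sup>2)\<^sup>2 / Q\<^sup>2) (at x)"
      by (simp only: power2_eq_square)
    have "((\<lambda>x. arcsin (m x)) has_real_derivative inverse (sqrt (1 - (m x)\<^sup>2)) * ((1 - a\<^sup>2)\<^sup>2 / Q\<^sup>2)) (at x)"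
      using DERIV_chain2[OF DERIV_arcsin dm] pm by simp
    moreover have "inverse (sqrt (1 - (m x)\<^sup>2)) * ((1 - a\<^sup>2)\<^sup>2 / Q\<^sup>2) = (1 - a\<^sup>2) / (Q * s)"
      unfolding sqrt_m using s(1) Q a2 by (simp add: field_simps power2_eq_square)
    ultimately have d1: "((\<lambda>x. arcsin (m x)) has_real_derivative (1 - a\<^sup>2) / (Q * s)) (at x)"
      by simp
    have d2: "(arcsin has_real_derivative 1 / s) (at x)"
      using DERIV_arcsin[of x] x by (simp add: s_def inverse_eq_divide)
    have d3: "((\<lambda>x. sqrt (1 - x\<^sup>2)) has_real_derivative - x / s) (at x)"
      unfolding s_def using x2 by (auto intro!: derivative_eq_intros simp: field_simps)
    have "(P has_real_derivative
        (1 / s * ((1 + a\<^sup>2) / (2 * a)) - (- x / s)) / (2 * a)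
        - (1 - a\<^sup>2) / (Q * s) * ((1 - a\<^sup>2) / (4 * a\<^sup>2))) (at x)"
      unfolding P_def by (intro DERIV_diff DERIV_cdivide DERIV_cmult_right d1 d2 d3)
    also have "(1 / s * ((1 + a\<^sup>2) / (2 * a)) - (- x / s)) / (2 * a)
        - (1 - a\<^sup>2) / (Q * s) * ((1 - a\<^sup>2) / (4 * a\<^sup>2)) =
        ((1 + a\<^sup>2 + 2 * a * x) * Q - (1 - a\<^sup>2)\<^sup>2) / (4 * a\<^sup>2 * Q * s)"
      using s(1) Q a(2) by (simp add: field_simps power2_eq_square)
    also have "(1 + a\<^sup>2 + 2 * a * x) * Q - (1 - a\<^sup>2)\<^sup>2 = 4 * a\<^sup>2 * s\<^sup>2"
      unfolding s(2) Q_def cheb_den_def by (simp add: algebra_simps power2_eq_square)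
    also have "4 * a\<^sup>2 * s\<^sup>2 / (4 * a\<^sup>2 * Q * s) = sqrt (1 - x\<^sup>2) / cheb_den a x"
      using s(1) Q a(2) unfolding s_def[symmetric] Q_def[symmetric] by (simp add: power2_eq_square)
    finally show "(P has_vector_derivative sqrt (1 - x\<^sup>2) / cheb_den a x) (at x)"
      by (simp add: has_real_derivative_iff_has_vector_derivative)
  qed simp
  ultimately show ?thesis by metis
qed

text \<open>
  The value at \<open>a = 0\<close>, where the antiderivative above breaks down, is the limit of the values at
  nonzero parameters.
\<close>

lemma integral_semicircle_1:
  assumes a: "\<bar>a\<bar> < 1"
  shows "integral {-1..1} (\<lambda>x. semicircle x / cheb_den a x) = 1"
proof -
  have nonzero: "integral {-1..1} (\<lambda>x. semicircle x / cheb_den u x) = 1" if "\<bar>u\<bar> < 1" "u \<noteq> 0" for u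
    using has_integral_mult_right[OF has_integral_sqrt_over_cheb_den[OF that], of "2 / pi"]
    by (intro integral_unique) (simp add: semicircle_def)
  have "integral {-1..1} (\<lambda>x. semicircle x / cheb_den 0 x) = 1"
    by (rule continuous_eq_at_puncture[where g = "\<lambda>_. 1",
          OF continuous_on_integral_over_cheb_den[OF continuous_on_semicircle]])
      (auto intro: nonzero)
  with nonzero a show ?thesis by (cases "a = 0") auto
qed

section \<open>Integrals with two to five parameters\<close>

lemma continuous_on_over_cheb_den:
  assumes "continuous_on {-1..1} h" "\<bar>a\<bar> < 1"
  shows "continuous_on {-1..1} (\<lambda>x. h x / cheb_den a x)"
  using cheb_den_pos[OF assms(2)] by (intro continuous_intros assms) fastforce

lemma integral_semicircle_2:
  assumes "\<bar>a\<bar> < 1" "\<bar>b\<bar> < 1"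
  shows "integral {-1..1} (\<lambda>x. semicircle x / cheb_den a x / cheb_den b x) = 1 / (1 - a * b)"
proof (rule integral_extra_cheb_den[where F = "\<lambda>_. 1"])
  show "continuous_on {-1<..<1} (\<lambda>u. 1 / (1 - a * u))"
    using one_minus_mult_nonzero[OF assms(1)] by (intro continuous_intros) auto
  show "(u - a) * (1 - a * u) * (1 / (1 - a * u)) = u * 1 - a * 1" if "\<bar>u\<bar> < 1" for u
    using one_minus_mult_nonzero[OF assms(1) that] by simp
qed (intro continuous_on_semicircle integral_semicircle_1 assms | assumption)+

lemma integral_semicircle_3:
  assumes "\<bar>a\<bar> < 1" "\<bar>b\<bar> < 1" "\<bar>c\<bar> < 1"
  shows "integral {-1..1} (\<lambda>x. semicircle x / cheb_den a x / cheb_den b x / cheb_den c x)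
    = 1 / ((1 - a * b) * (1 - a * c) * (1 - b * c))"
proof (rule integral_extra_cheb_den[where F = "\<lambda>u. 1 / (1 - a * u)"])
  note nz = one_minus_mult_nonzero
  show "continuous_on {-1<..<1} (\<lambda>u. 1 / ((1 - a * b) * (1 - a * u) * (1 - b * u)))"
    using nz[OF assms(1)] nz[OF assms(2)] assms by (intro continuous_intros) auto
  show "(u - b) * (1 - b * u) * (1 / ((1 - a * b) * (1 - a * u) * (1 - b * u)))
      = u * (1 / (1 - a * u)) - b * (1 / (1 - a * b))" if u: "\<bar>u\<bar> < 1" for u
    using nz[OF assms(1,2)] nz[OF assms(1) u] nz[OF assms(2) u]
    by (simp add: divide_simps) (simp add: algebra_simps)
qed (intro continuous_on_over_cheb_den continuous_on_semicircle integral_semicircle_2 assms | assumption)+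

text \<open>
  The product formula breaks here: the quotient by \<open>u - c\<close> no longer cancels completely and leaves the
  numerator \<open>1 - a b c d\<close>.
\<close>

lemma integral_semicircle_4:
  assumes "\<bar>a\<bar> < 1" "\<bar>b\<bar> < 1" "\<bar>c\<bar> < 1" "\<bar>d\<bar> < 1"
  shows "integral {-1..1} (\<lambda>x. semicircle x / cheb_den a x / cheb_den b x / cheb_den c x / cheb_den d x)
    = (1 - a * b * c * d)
      / ((1 - a * b) * (1 - a * c) * (1 - a * d) * (1 - b * c) * (1 - b * d) * (1 - c * d))"
proof (rule integral_extra_cheb_den[where F = "\<lambda>u. 1 / ((1 - a * b) * (1 - a * u) * (1 - b * u))"])
  note nz = one_minus_mult_nonzero
  show "continuous_on {-1<..<1} (\<lambda>u. (1 - a * b * c * u)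
      / ((1 - a * b) * (1 - a * c) * (1 - a * u) * (1 - b * c) * (1 - b * u) * (1 - c * u)))"
    using nz[OF assms(1)] nz[OF assms(2)] nz[OF assms(3)] assms by (intro continuous_intros) auto
  show "(u - c) * (1 - c * u) * ((1 - a * b * c * u)
      / ((1 - a * b) * (1 - a * c) * (1 - a * u) * (1 - b * c) * (1 - b * u) * (1 - c * u)))
      = u * (1 / ((1 - a * b) * (1 - a * u) * (1 - b * u)))
        - c * (1 / ((1 - a * b) * (1 - a * c) * (1 - b * c)))" if u: "\<bar>u\<bar> < 1" for u
  proof -
    have cleared: "(u - c) * (1 - a * b * c * u)
        = u * ((1 - a * c) * (1 - b * c)) - c * ((1 - a * u) * (1 - b * u))"
      by (simp add: algebra_simps)
    \<comment> \<open>The factors are grouped as free of both \<open>c\<close> and \<open>u\<close>, involving \<open>c\<close> only, and involving \<open>u\<close> only.\<close>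
    define p q r where "p = 1 - a * b" and "q = (1 - a * c) * (1 - b * c)"
      and "r = (1 - a * u) * (1 - b * u)"
    define t where "t = 1 - c * u"
    have "p \<noteq> 0" "q \<noteq> 0" "r \<noteq> 0" "t \<noteq> 0"
      unfolding p_def q_def r_def t_def using nz assms u by simp_all
    then have "(u - c) * t * ((1 - a * b * c * u) / (p * q * r * t))
        = ((u - c) * (1 - a * b * c * u)) / (p * q * r)"
      by simp
    also have "\<dots> = u * (1 / (p * r)) - c * (1 / (p * q))"
      unfolding cleared q_def[symmetric] r_def[symmetric]
      using \<open>p \<noteq> 0\<close> \<open>q \<noteq> 0\<close> \<open>r \<noteq> 0\<close> by (simp add: field_simps)
    finally show ?thesis unfolding p_def q_def r_def t_def by (simp only: mult_ac)
  qed
qed (intro continuous_on_over_cheb_den continuous_on_semicircle integral_semicircle_3 assms | assumption)+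

text \<open>
  Clearing denominators in \<open>(u F(u) - d F(d)) / ((u - d)(1 - d u))\<close>, where \<open>F\<close> is the four-parameter
  formula as a function of its last parameter, gives the identity \<open>cleared\<close> below. Its right-hand side is
  antisymmetric in \<open>u\<close> and \<open>d\<close>, hence divisible by \<open>u - d\<close>, and the quotient is \<open>1 - e\<^sub>4 + e\<^sub>5 e\<^sub>1 - e\<^sub>5\<^sup>2\<close> for the
  parameters \<open>a\<close>, \<open>b\<close>, \<open>c\<close>, \<open>d\<close> and \<open>u\<close>.
\<close>

lemma integral_semicircle_5:
  fixes a b c d e :: real
  defines "e5 \<equiv> a * b * c * d * e"
  assumes "\<bar>a\<bar> < 1" "\<bar>b\<bar> < 1" "\<bar>c\<bar> < 1" "\<bar>d\<bar> < 1" "\<bar>e\<bar> < 1"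
  shows "integral {-1..1}
      (\<lambda>x. semicircle x / cheb_den a x / cheb_den b x / cheb_den c x / cheb_den d x / cheb_den e x)
    = (1 - (a * b * c * d + a * b * c * e + a * b * d * e + a * c * d * e + b * c * d * e)
        + e5 * (a + b + c + d + e) - e5\<^sup>2)
      / ((1 - a * b) * (1 - a * c) * (1 - a * d) * (1 - a * e) * (1 - b * c) * (1 - b * d)
        * (1 - b * e) * (1 - c * d) * (1 - c * e) * (1 - d * e))"
  unfolding e5_def
proof (rule integral_extra_cheb_den[where F = "\<lambda>u. (1 - a * b * c * u)
      / ((1 - a * b) * (1 - a * c) * (1 - a * u) * (1 - b * c) * (1 - b * u) * (1 - c * u))"])
  note nz = one_minus_mult_nonzero and assms = assms(2-)
  let ?N = "\<lambda>u. 1 - (a * b * c * d + a * b * c * u + a * b * d * u + a * c * d * u + b * c * d * u)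
        + a * b * c * d * u * (a + b + c + d + u) - (a * b * c * d * u)\<^sup>2"
  show "continuous_on {-1<..<1} (\<lambda>u. ?N u
      / ((1 - a * b) * (1 - a * c) * (1 - a * d) * (1 - a * u) * (1 - b * c) * (1 - b * d)
        * (1 - b * u) * (1 - c * d) * (1 - c * u) * (1 - d * u)))"
    using nz[OF assms(1)] nz[OF assms(2)] nz[OF assms(3)] nz[OF assms(4)] assms
    by (intro continuous_intros) auto
  show "(u - d) * (1 - d * u) * (?N u
      / ((1 - a * b) * (1 - a * c) * (1 - a * d) * (1 - a * u) * (1 - b * c) * (1 - b * d)
        * (1 - b * u) * (1 - c * d) * (1 - c * u) * (1 - d * u)))
      = u * ((1 - a * b * c * u)
          / ((1 - a * b) * (1 - a * c) * (1 - a * u) * (1 - b * c) * (1 - b * u) * (1 - c * u)))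
        - d * ((1 - a * b * c * d)
          / ((1 - a * b) * (1 - a * c) * (1 - a * d) * (1 - b * c) * (1 - b * d) * (1 - c * d)))"
    if u: "\<bar>u\<bar> < 1" for u
  proof -
    have cleared: "(u - d) * ?N u
        = u * (1 - a * b * c * u) * ((1 - a * d) * (1 - b * d) * (1 - c * d))
          - d * (1 - a * b * c * d) * ((1 - a * u) * (1 - b * u) * (1 - c * u))"
      by (simp add: algebra_simps power2_eq_square)
    \<comment> \<open>The factors are grouped as free of both \<open>d\<close> and \<open>u\<close>, involving \<open>d\<close> only, and involving \<open>u\<close> only.\<close>
    define p q r where "p = (1 - a * b) * (1 - a * c) * (1 - b * c)"
      and "q = (1 - a * d) * (1 - b * d) * (1 - c * d)"
      and "r = (1 - a * u) * (1 - b * u) * (1 - c * u)"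
    define t where "t = 1 - d * u"
    have "p \<noteq> 0" "q \<noteq> 0" "r \<noteq> 0" "t \<noteq> 0"
      unfolding p_def q_def r_def t_def using nz assms u by simp_all
    then have "(u - d) * t * (?N u / (p * q * r * t)) = ((u - d) * ?N u) / (p * q * r)"
      by simp
    also have "\<dots> = u * ((1 - a * b * c * u) / (p * r)) - d * ((1 - a * b * c * d) / (p * q))"
      unfolding cleared q_def[symmetric] r_def[symmetric]
      using \<open>p \<noteq> 0\<close> \<open>q \<noteq> 0\<close> \<open>r \<noteq> 0\<close> by (simp add: field_simps)
    finally show ?thesis unfolding p_def q_def r_def t_def by (simp only: mult_ac)
  qed
qed (intro continuous_on_over_cheb_den continuous_on_semicircle integral_semicircle_4 assms | assumption)+

section \<open>Elementary symmetric functions and pair products of five numbers\<close>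

lemma elem_sym5_1: "elem_sym5 1 a = a 1 + a 2 + a 3 + a 4 + a 5"
proof -
  have eq: "{N. N \<subseteq> {1..5} \<and> card N = 1} = (\<lambda>m. {m}) ` {1..5::nat}"
    by (auto simp: card_1_singleton_iff)
  show ?thesis
    unfolding elem_sym5_def eq by (subst sum.reindex) (auto simp: numeral_eq_Suc)
qed

lemma elem_sym5_4:
  "elem_sym5 4 a = a 1 * a 2 * a 3 * a 4 + a 1 * a 2 * a 3 * a 5 + a 1 * a 2 * a 4 * a 5
    + a 1 * a 3 * a 4 * a 5 + a 2 * a 3 * a 4 * a 5"
proof -
  have "N \<in> (\<lambda>m. {1..5} - {m}) ` {1..5}" if N: "N \<subseteq> {1..5::nat}" "card N = 4" for N
  proof -
    \<comment> \<open>A subset with four of the five elements is determined by the one it omits.\<close>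
    have "card ({1..5} - N) = 1" using N by (simp add: card_Diff_subset finite_subset)
    then obtain m where m: "{1..5} - N = {m}" by (auto simp: card_1_singleton_iff)
    then have "N = {1..5} - {m}" "m \<in> {1..5}" using N by blast+
    then show ?thesis by blast
  qed
  then have eq: "{N. N \<subseteq> {1..5} \<and> card N = 4} = (\<lambda>m. {1..5} - {m}) ` {1..5::nat}"
    by (auto simp: card_Diff_subset)
  have inj: "inj_on (\<lambda>m. {1..5} - {m}) {1..5::nat}"
    by (rule inj_onI) blast
  have set5: "{1..5::nat} = {1, 2, 3, 4, 5}" by auto
  have "elem_sym5 4 a = (\<Sum>m\<in>{1..5}. prod a ({1..5} - {m}))"
    unfolding elem_sym5_def eq sum.reindex[OF inj] by simp
  then show ?thesis
    unfolding set5 by (simp add: insert_Diff_if mult_ac)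
qed

lemma elem_sym5_5: "elem_sym5 5 a = a 1 * a 2 * a 3 * a 4 * a 5"
proof -
  have eq: "{N. N \<subseteq> {1..5} \<and> card N = 5} = {{1..5::nat}}"
    using card_subset_eq[of "{1..5::nat}"] by auto
  have set5: "{1..5::nat} = {1, 2, 3, 4, 5}" by auto
  have "elem_sym5 5 a = prod a {1..5}"
    unfolding elem_sym5_def eq by simp
  then show ?thesis unfolding set5 by (simp add: mult_ac)
qed

lemma prod_1_to_5: "(\<Prod>j=1..5. f j) = f 1 * f 2 * f 3 * f 4 * (f 5 :: real)" for f :: "nat \<Rightarrow> real"
  by (simp add: numeral_eq_Suc mult_ac)

lemma pair_product_5:
  fixes a :: "nat \<Rightarrow> real"
  shows "(\<Prod>j=1..5. \<Prod>k=j+1..5. 1 - a j * a k)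
    = (1 - a 1 * a 2) * (1 - a 1 * a 3) * (1 - a 1 * a 4) * (1 - a 1 * a 5) * (1 - a 2 * a 3)
      * (1 - a 2 * a 4) * (1 - a 2 * a 5) * (1 - a 3 * a 4) * (1 - a 3 * a 5) * (1 - a 4 * a 5)"
proof -
  have ranges: "{1 + 1..5::nat} = {2, 3, 4, 5}" "{2 + 1..5::nat} = {3, 4, 5}"
    "{3 + 1..5::nat} = {4, 5}" "{4 + 1..5::nat} = {5}" "{5 + 1..5::nat} = {}"
    by auto
  show ?thesis unfolding prod_1_to_5 ranges by simp
qed

section \<open>The expansion and the integral\<close>

theorem theorem2:
  fixes a :: "nat \<Rightarrow> real"
  assumes "\<And>j. j \<in> {1..5} \<Longrightarrow> \<bar>a j\<bar> < 1"
  shows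
    "(\<forall>n::nat. sigma4 n (a 1) (a 2) (a 3) (a 4) 0 =
        S_poly (int n) [a 2, a 4] 0
        + (1 - a 2 * a 4) * (1 - a 1 * a 4) / (1 - a 1 * a 2 * a 3 * a 4)
            * a 3 * S_poly (int n - 1) [a 2, a 3, a 4] 0
        + (1 - a 2 * a 4) * (1 - a 3 * a 2) / (1 - a 1 * a 2 * a 3 * a 4)
            * a 1 * S_poly (int n - 1) [a 1, a 2, a 4] 0
        + (1 - a 2 * a 4) * (1 - a 2 * a 3) * (1 - a 1 * a 4) * a 1 * a 3
              / (1 - a 1 * a 2 * a 3 * a 4)
            * S_poly (int n - 2) [a 1, a 2, a 3, a 4] 0)
     \<and> (g5_q0 a has_integral
          (1 - elem_sym5 4 a + elem_sym5 5 a * elem_sym5 1 a - (elem_sym5 5 a)\<^sup>2)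
            / (\<Prod>j=1..5. \<Prod>k=j+1..5. 1 - a j * a k)) {-1..1}"
proof (intro conjI allI)
  show "sigma4 n (a 1) (a 2) (a 3) (a 4) 0 =
        S_poly (int n) [a 2, a 4] 0
        + (1 - a 2 * a 4) * (1 - a 1 * a 4) / (1 - a 1 * a 2 * a 3 * a 4)
            * a 3 * S_poly (int n - 1) [a 2, a 3, a 4] 0
        + (1 - a 2 * a 4) * (1 - a 3 * a 2) / (1 - a 1 * a 2 * a 3 * a 4)
            * a 1 * S_poly (int n - 1) [a 1, a 2, a 4] 0
        + (1 - a 2 * a 4) * (1 - a 2 * a 3) * (1 - a 1 * a 4) * a 1 * a 3
              / (1 - a 1 * a 2 * a 3 * a 4)
            * S_poly (int n - 2) [a 1, a 2, a 3, a 4] 0" for n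
    by (rule sigma4_expansion)
  have bounds: "\<bar>a 1\<bar> < 1" "\<bar>a 2\<bar> < 1" "\<bar>a 3\<bar> < 1" "\<bar>a 4\<bar> < 1" "\<bar>a 5\<bar> < 1"
    by (simp_all add: assms)
  have g5: "g5_q0 a =
      (\<lambda>x. semicircle x / cheb_den (a 1) x / cheb_den (a 2) x / cheb_den (a 3) x / cheb_den (a 4) x / cheb_den (a 5) x)"
    unfolding fun_eq_iff g5_q0_def prod_1_to_5 semicircle_def cheb_den_def by simp
  have "continuous_on {-1..1} (g5_q0 a)"
    unfolding g5 by (intro continuous_on_over_cheb_den continuous_on_semicircle bounds)
  then have "(g5_q0 a has_integral integral {-1..1} (g5_q0 a)) {-1..1}"
    by (intro integrable_integral integrable_continuous_real)
  also have "integral {-1..1} (g5_q0 a) =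
      (1 - elem_sym5 4 a + elem_sym5 5 a * elem_sym5 1 a - (elem_sym5 5 a)\<^sup>2)
        / (\<Prod>j=1..5. \<Prod>k=j+1..5. 1 - a j * a k)"
    unfolding g5 integral_semicircle_5[OF bounds] elem_sym5_1 elem_sym5_4 elem_sym5_5 pair_product_5 ..
  finally show "(g5_q0 a has_integral
      (1 - elem_sym5 4 a + elem_sym5 5 a * elem_sym5 1 a - (elem_sym5 5 a)\<^sup>2)
        / (\<Prod>j=1..5. \<Prod>k=j+1..5. 1 - a j * a k)) {-1..1}" .
qed

end
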